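(* Let $S$ be a semiring and $B$ a weak content $S$-semialgebra such that the corresponding homomorphism $\lambda:S\to B$ is injective and the content function $c$ is homogeneous. If $\mathbf p$ is a strong Krull prime of $S$, then either $\mathbf pB=B$ or $\mathbf pB$ is a strong Krull prime of $B$.
   Context: A semiring is a set $S$ with operations $+,\cdot$ such that $(S,+)$ is a commutative monoid with identity $0$, $(S,\cdot)$ is a commutative monoid with identity $1\neq 0$, multiplication distributes over addition, and $s\cdot 0=0$ for all $s\in S$. An ideal of $S$ is a nonempty subset closed under addition and under multiplication by elements of $S$; a proper ideal $\mathbf p$ is prime if $ab\in\mathbf p$ implies $a\in\mathbf p$ or $b\in\mathbf p$. $\sqrt I=\{s\in S:s^n\in I\text{ for some }n\ge1\}$. An $S$-semialgebra is a semiring $B$ with a semiring morphism $\lambda:S\to B$ (preserving $+,\cdot,0,1$); write $s\cdot f=\lambda(s)f$, and for an ideal $I$ of $S$ let $IB$ be the ideal of $B$ generated by $\lambda(I)$. For $f\in B$, the content $c(f)$ is the intersection of all ideals $I$ of $S$ with $f\in IB$. $B$ is an Ohm-Rush $S$-semialgebra if $f\in c(f)B$ for all $f\in B$. $B$ is a weak content $S$-semialgebra if it is Ohm-Rush and $c(f)c(g)\subseteq\sqrt{c(fg)}$ for all $f,g\in B$. The content function is homogeneous if $c(s\cdot f)=s\cdot c(f)$ for all $s\in S$, $f\in B$. A prime ideal $\mathbf p$ of a semiring $S$ is a strong Krull prime of $S$ if for every finitely generated ideal $I$ of $S$ with $I\subseteq\mathbf p$ there exists $z\in S$ such that $I\subseteq\mathrm{Ann}(z)\subseteq\mathbf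 p$, where $\mathrm{Ann}(z)=\{s\in S: sz=0\}$. *)

theory Defs
  imports Main "HOL.Hull"
begin

text \<open>
  Semirings are commutative with \<open>1 \<noteq> 0\<close> and absorbing \<open>0\<close>; this is exactly the type class
  \<^class>\<open>comm_semiring_1\<close>, a semiring being identified with its type.
\<close>

definition semiring_ideal :: "'a::comm_semiring_1 set \<Rightarrow> bool" where
  "semiring_ideal I \<longleftrightarrow>
     I \<noteq> {} \<and> (\<forall>a\<in>I. \<forall>b\<in>I. a + b \<in> I) \<and> (\<forall>s. \<forall>a\<in>I. s * a \<in> I)"

definition prime_semiring_ideal :: "'a::comm_semiring_1 set \<Rightarrow> bool" where
  "prime_semiring_ideal p \<longleftrightarrow>
     semiring_ideal p \<and> p \<noteq> UNIV \<and> (\<forall>a b. a * b \<in> p \<longrightarrow> a \<in> p \<or> b \<in> p)"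

definition ideal_radical :: "'a::comm_semiring_1 set \<Rightarrow> 'a set" where
  "ideal_radical I = {s. \<exists>n\<ge>1. s ^ n \<in> I}"

definition fg_semiring_ideal :: "'a::comm_semiring_1 set \<Rightarrow> bool" where
  "fg_semiring_ideal I \<longleftrightarrow> (\<exists>X. finite X \<and> I = semiring_ideal hull X)"

definition ideal_mult :: "'a::comm_semiring_1 set \<Rightarrow> 'a set \<Rightarrow> 'a set" where
  "ideal_mult I J = semiring_ideal hull {a * b | a b. a \<in> I \<and> b \<in> J}"

definition annihilator :: "'a::comm_semiring_1 \<Rightarrow> 'a set" where
  "annihilator z = {s. s * z = 0}"

definition strong_krull_prime :: "'a::comm_semiring_1 set \<Rightarrow> bool" where
  "strong_krull_prime p \<longleftrightarrow>
     prime_semiring_ideal p \<and>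
     (\<forall>I. fg_semiring_ideal I \<and> I \<subseteq> p \<longrightarrow> (\<exists>z. I \<subseteq> annihilator z \<and> annihilator z \<subseteq> p))"

text \<open>
  An \<open>S\<close>-semialgebra \<open>B\<close> is given by its structure morphism \<open>lam : S \<rightarrow> B\<close>, with
  \<open>s \<cdot> f = lam s * f\<close>.
\<close>

definition semiring_morphism :: "('a::comm_semiring_1 \<Rightarrow> 'b::comm_semiring_1) \<Rightarrow> bool" where
  "semiring_morphism lam \<longleftrightarrow>
     (\<forall>a b. lam (a + b) = lam a + lam b) \<and> (\<forall>a b. lam (a * b) = lam a * lam b) \<and>
     lam 0 = 0 \<and> lam 1 = 1"

definition ideal_extension ::
    "('a::comm_semiring_1 \<Rightarrow> 'b::comm_semiring_1) \<Rightarrow> 'a set \<Rightarrow> 'b set" where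
  "ideal_extension lam I = semiring_ideal hull (lam ` I)"

definition content :: "('a::comm_semiring_1 \<Rightarrow> 'b::comm_semiring_1) \<Rightarrow> 'b \<Rightarrow> 'a set" where
  "content lam f = \<Inter>{I. semiring_ideal I \<and> f \<in> ideal_extension lam I}"

definition ohm_rush :: "('a::comm_semiring_1 \<Rightarrow> 'b::comm_semiring_1) \<Rightarrow> bool" where
  "ohm_rush lam \<longleftrightarrow>
     semiring_morphism lam \<and> (\<forall>f. f \<in> ideal_extension lam (content lam f))"

definition weak_content_semialgebra ::
    "('a::comm_semiring_1 \<Rightarrow> 'b::comm_semiring_1) \<Rightarrow> bool" where
  "weak_content_semialgebra lam \<longleftrightarrow>
     ohm_rush lam \<and>
     (\<forall>f g. ideal_mult (content lam f) (content lam g) \<subseteq> ideal_radical (content lam (f * g)))"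

definition homogeneous_content ::
    "('a::comm_semiring_1 \<Rightarrow> 'b::comm_semiring_1) \<Rightarrow> bool" where
  "homogeneous_content lam \<longleftrightarrow>
     (\<forall>s f. content lam (lam s * f) = (\<lambda>a. s * a) ` content lam f)"

end

theory Submission
  imports Defs
begin

text \<open>
  By the Ohm-Rush property, \<open>f \<in> IB\<close> iff \<open>c(f) \<subseteq> I\<close>; primality of \<open>\<^bold>pB\<close> is then immediate from the
  weak content inclusion. A finite subset of \<open>\<^bold>pB\<close> lies in \<open>AB\<close> for some finite \<open>A \<subseteq> \<^bold>p\<close>. If \<open>z\<close> is
  the witness that \<open>A\<close> provides in \<open>S\<close>, then \<open>\<lambda>(z)\<close> is a witness in \<open>B\<close>: homogeneity turns
  \<open>\<lambda>(z)g = 0\<close> into \<open>z c(g) = c(0) = 0\<close>, so that \<open>c(g) \<subseteq> Ann(z) \<subseteq> \<^bold>p\<close>.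
\<close>

lemma semiring_ideal_zero: "semiring_ideal I \<Longrightarrow> 0 \<in> I"
  unfolding semiring_ideal_def by (metis all_not_in_conv mult_zero_left)

text \<open>Nonemptiness is the delicate clause: all members share \<open>0\<close>, and an empty
  family has intersection \<open>UNIV\<close>. This is what makes hulls and contents ideals.\<close>

lemma semiring_ideal_Inter:
  assumes "\<And>I. I \<in> F \<Longrightarrow> semiring_ideal I"
  shows "semiring_ideal (\<Inter>F)"
proof -
  have "0 \<in> \<Inter>F"
    using assms semiring_ideal_zero by blast
  then show ?thesis
    using assms unfolding semiring_ideal_def by blast
qed

lemma semiring_ideal_hull: "semiring_ideal (semiring_ideal hull X)"
  by (rule hull_in) (auto intro: semiring_ideal_Inter)

lemma semiring_ideal_content: "semiring_ideal (content lam f)"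
  unfolding content_def by (auto intro: semiring_ideal_Inter)

lemma semiring_ideal_annihilator: "semiring_ideal (annihilator z)"
proof -
  have "0 \<in> annihilator z"
    by (simp add: annihilator_def)
  then have "annihilator z \<noteq> {}"
    by blast
  then show ?thesis
    unfolding semiring_ideal_def
    by (simp add: annihilator_def distrib_right mult.assoc)
qed

lemma ideal_extension_mono: "I \<subseteq> J \<Longrightarrow> ideal_extension lam I \<subseteq> ideal_extension lam J"
  unfolding ideal_extension_def by (intro hull_mono image_mono)

text \<open>Finite subsets of \<open>X\<close> are directed under union, so the elements reached
  from some finite subset already form an ideal \<open>D\<close> containing \<open>X\<close>;
  minimality of the hull places \<open>f\<close> in \<open>D\<close>.\<close>

lemma hull_finite_subset:
  assumes "f \<in> semiring_ideal hull X"
  obtains Y where "finite Y" "Y \<subseteq> X" "f \<in> semiring_ideal hull Y"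
proof -
  define D where "D = {f. \<exists>Y. finite Y \<and> Y \<subseteq> X \<and> f \<in> semiring_ideal hull Y}"
  have "0 \<in> D"
    unfolding D_def using semiring_ideal_zero[OF semiring_ideal_hull] by blast
  moreover have "a + b \<in> D" if ab: "a \<in> D" "b \<in> D" for a b
  proof -
    obtain Y Z where Y: "finite Y" "Y \<subseteq> X" "a \<in> semiring_ideal hull Y"
      and Z: "finite Z" "Z \<subseteq> X" "b \<in> semiring_ideal hull Z"
      using ab unfolding D_def by blast
    have "a \<in> semiring_ideal hull (Y \<union> Z)" "b \<in> semiring_ideal hull (Y \<union> Z)"
      using Y Z hull_mono[of Y "Y \<union> Z"] hull_mono[of Z "Y \<union> Z"] by blast+
    then have "a + b \<in> semiring_ideal hull (Y \<union> Z)"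
      using semiring_ideal_hull[of "Y \<union> Z"] unfolding semiring_ideal_def by blast
    then show ?thesis
      unfolding D_def using Y Z by (intro CollectI exI[of _ "Y \<union> Z"]) auto
  qed
  moreover have "s * a \<in> D" if "a \<in> D" for s a
  proof -
    obtain Y where Y: "finite Y" "Y \<subseteq> X" "a \<in> semiring_ideal hull Y"
      using \<open>a \<in> D\<close> unfolding D_def by blast
    then have "s * a \<in> semiring_ideal hull Y"
      using semiring_ideal_hull[of Y] unfolding semiring_ideal_def by blast
    then show ?thesis
      unfolding D_def using Y by blast
  qed
  ultimately have "semiring_ideal D"
    unfolding semiring_ideal_def by blast
  moreover have "X \<subseteq> D"
  proof
    fix x assume "x \<in> X"
    then show "x \<in> D"
      unfolding D_def by (intro CollectI exI[of _ "{x}"]) (simp add: hull_inc)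
  qed
  ultimately have "f \<in> D"
    using assms hull_minimal[of X D semiring_ideal] by blast
  then show ?thesis
    unfolding D_def using that by blast
qed

text \<open>Here \<open>A\<close> is a bare finite set, not an ideal; \<open>ideal_extension\<close>
  still makes sense and gives the ideal generated by the image of \<open>A\<close>. This reduces a
  finitely generated ideal of \<open>B\<close> to finitely many elements of
  \<open>S\<close>.\<close>

lemma ideal_extension_finite_subset:
  assumes "finite X" "X \<subseteq> ideal_extension lam I"
  obtains A where "finite A" "A \<subseteq> I" "X \<subseteq> ideal_extension lam A"
proof -
  have "\<exists>A. finite A \<and> A \<subseteq> I \<and> X \<subseteq> ideal_extension lam A"
    using assms
  proof (induction X rule: finite_induct)
    case empty
    then show ?case by blast
  next
    case (insert x X)
    then obtain A where A: "finite A" "A \<subseteq> I" "X \<subseteq> ideal_extension lam A"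
      by auto
    obtain Y where Y: "finite Y" "Y \<subseteq> lam ` I" "x \<in> semiring_ideal hull Y"
      using insert.prems hull_finite_subset unfolding ideal_extension_def by blast
    \<comment> \<open>One preimage in \<open>I\<close> for each element of \<open>Y\<close>
      suffices.\<close>
    obtain C where C: "finite C" "C \<subseteq> I" "Y = lam ` C"
      using Y finite_subset_image by metis
    have "x \<in> ideal_extension lam C"
      using Y C by (simp add: ideal_extension_def)
    then have "insert x X \<subseteq> ideal_extension lam (A \<union> C)"
      using A(3) ideal_extension_mono[of A "A \<union> C" lam] ideal_extension_mono[of C "A \<union> C" lam]
      by blast
    then show ?case
      using A C by (intro exI[of _ "A \<union> C"]) auto
  qed
  then show ?thesis
    using that by blast
qed

text \<open>Left to right, \<open>I\<close> is one of the ideals intersected in the content; right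
  to left, the Ohm-Rush property combines with monotonicity of extension.\<close>

lemma ideal_extension_iff_content:
  assumes "ohm_rush lam" "semiring_ideal I"
  shows "f \<in> ideal_extension lam I \<longleftrightarrow> content lam f \<subseteq> I"
proof
  show "content lam f \<subseteq> I" if "f \<in> ideal_extension lam I"
    using that assms unfolding content_def by blast
  show "f \<in> ideal_extension lam I" if "content lam f \<subseteq> I"
    using that assms ideal_extension_mono unfolding ohm_rush_def by blast
qed

lemma content_zero: "content lam 0 = {0}"
proof -
  have "semiring_ideal {0::'a}"
    by (simp add: semiring_ideal_def)
  moreover have "0 \<in> ideal_extension lam {0}"
    unfolding ideal_extension_def by (rule semiring_ideal_zero[OF semiring_ideal_hull])
  ultimately have "content lam 0 \<subseteq> {0}"
    unfolding content_def by blast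
  then show ?thesis
    using semiring_ideal_zero[OF semiring_ideal_content, of lam 0] by blast
qed

lemma prime_semiring_ideal_power:
  assumes "prime_semiring_ideal p" "s ^ n \<in> p"
  shows "s \<in> p"
  using assms(2)
proof (induction n)
  case 0
  \<comment> \<open>Exponent 0 puts \<open>1\<close> in \<open>p\<close>, hence every
    \<open>x\<close>, in particular \<open>s\<close>.\<close>
  then have "x * 1 \<in> p" for x
    using assms(1) unfolding prime_semiring_ideal_def semiring_ideal_def power_0 by blast
  then show ?case
    by simp
next
  case (Suc n)
  then show ?case
    using assms(1) unfolding prime_semiring_ideal_def by auto
qed

lemma prime_ideal_extension:
  assumes "weak_content_semialgebra lam" "prime_semiring_ideal p"
    and "ideal_extension lam p \<noteq> UNIV"
  shows "prime_semiring_ideal (ideal_extension lam p)"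
proof -
  have p: "semiring_ideal p"
    using assms(2) by (simp add: prime_semiring_ideal_def)
  have iff: "f \<in> ideal_extension lam p \<longleftrightarrow> content lam f \<subseteq> p" for f
    using assms(1) p ideal_extension_iff_content by (auto simp: weak_content_semialgebra_def)
  have "f \<in> ideal_extension lam p \<or> g \<in> ideal_extension lam p"
    if fg: "f * g \<in> ideal_extension lam p" for f g
  proof -
    have "a * b \<in> p" if "a \<in> content lam f" "b \<in> content lam g" for a b
    proof -
      have "a * b \<in> ideal_mult (content lam f) (content lam g)"
        unfolding ideal_mult_def using that by (intro hull_inc) blast
      then obtain n where "(a * b) ^ n \<in> content lam (f * g)"
        using assms(1) unfolding weak_content_semialgebra_def ideal_radical_def by blast
      then show ?thesis
        using fg iff prime_semiring_ideal_power[OF assms(2)] by blast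
    qed
    \<comment> \<open>If neither content lay in \<open>p\<close>, elements \<open>a\<close> and
      \<open>b\<close> of the two contents outside \<open>p\<close> would have their product in
      \<open>p\<close>.\<close>
    then show ?thesis
      using assms(2) unfolding iff prime_semiring_ideal_def by blast
  qed
  then show ?thesis
    using assms(3) semiring_ideal_hull
    unfolding prime_semiring_ideal_def ideal_extension_def by blast
qed

theorem lemma4p12:
  fixes lam :: "'a::comm_semiring_1 \<Rightarrow> 'b::comm_semiring_1"
    and p :: "'a set"
  assumes "weak_content_semialgebra lam"
    and "inj lam"
    and "homogeneous_content lam"
    and "strong_krull_prime p"
  shows "ideal_extension lam p = UNIV \<or> strong_krull_prime (ideal_extension lam p)"
proof (cases "ideal_extension lam p = UNIV")
  case True
  then show ?thesis ..
next
  case proper: False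
  have ohm: "ohm_rush lam"
    using assms(1) by (simp add: weak_content_semialgebra_def)
  then have lam: "lam (a * b) = lam a * lam b" "lam 0 = 0" for a b
    by (auto simp: ohm_rush_def semiring_morphism_def)
  have prime: "prime_semiring_ideal p"
    using assms(4) by (simp add: strong_krull_prime_def)
  then have p: "semiring_ideal p"
    by (simp add: prime_semiring_ideal_def)
  have "\<exists>w. J \<subseteq> annihilator w \<and> annihilator w \<subseteq> ideal_extension lam p"
    if fg: "fg_semiring_ideal J" and J: "J \<subseteq> ideal_extension lam p" for J
  proof -
    obtain X where X: "finite X" "J = semiring_ideal hull X"
      using fg unfolding fg_semiring_ideal_def by blast
    then have "X \<subseteq> ideal_extension lam p"
      using J hull_subset[of X semiring_ideal] by blast
    then obtain A where A: "finite A" "A \<subseteq> p" "X \<subseteq> ideal_extension lam A"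
      using ideal_extension_finite_subset[OF X(1)] by metis
    \<comment> \<open>The strong Krull condition concerns ideals, so it is applied to the ideal
      generated by \<open>A\<close>, which stays inside the ideal \<open>p\<close>.\<close>
    have "fg_semiring_ideal (semiring_ideal hull A)" "semiring_ideal hull A \<subseteq> p"
      using A p by (auto simp: fg_semiring_ideal_def hull_minimal)
    then obtain z where z: "semiring_ideal hull A \<subseteq> annihilator z" "annihilator z \<subseteq> p"
      using assms(4) unfolding strong_krull_prime_def by blast
    have "a * z = 0" if "a \<in> A" for a
      using that z(1) hull_inc[of a A semiring_ideal] by (auto simp: annihilator_def)
    then have "lam a * lam z = 0" if "a \<in> A" for a
      using that lam(1)[of a z] lam(2) by simp
    then have "lam ` A \<subseteq> annihilator (lam z)"
      by (auto simp: annihilator_def)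
    \<comment> \<open>An annihilator is an ideal, so it is enough that \<open>lam z\<close> kills
      the generators; the same argument then passes from \<open>X\<close> to
      \<open>J\<close>.\<close>
    then have "ideal_extension lam A \<subseteq> annihilator (lam z)"
      unfolding ideal_extension_def by (rule hull_minimal) (rule semiring_ideal_annihilator)
    then have "J \<subseteq> annihilator (lam z)"
      unfolding X(2) using A(3) by (intro hull_minimal semiring_ideal_annihilator) blast
    moreover have "annihilator (lam z) \<subseteq> ideal_extension lam p"
    proof
      fix g assume "g \<in> annihilator (lam z)"
      then have "lam z * g = 0"
        by (simp add: annihilator_def mult.commute)
      then have "(\<lambda>a. z * a) ` content lam g = {0}"
        using assms(3) content_zero unfolding homogeneous_content_def by metis
      then have "content lam g \<subseteq> annihilator z"
        by (auto simp: annihilator_def mult.commute)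
      then show "g \<in> ideal_extension lam p"
        using z(2) ideal_extension_iff_content[OF ohm p] by blast
    qed
    ultimately show ?thesis by blast
  qed
  then show ?thesis
    using prime_ideal_extension[OF assms(1) prime proper] unfolding strong_krull_prime_def by blast
qed

end
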